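(* Let $G$ be a countable discrete group with $|G|\ge4$. Then there exists a unitary $u\in L(G)$ with $\tau(u)=0$ and with at least two non-zero Fourier coefficients, i.e. there are distinct $g,h\in G$ with $\widehat{u}(g)\ne0$ and $\widehat{u}(h)\neq0$.
   Context: $L(G)=\{\lambda_g:g\in G\}''\subseteq B(\ell^2(G))$ is the group von Neumann algebra with canonical trace $\tau(x)=\langle x\delta_e,\delta_e\rangle$. For $x\in L(G)$ and $g\in G$, the Fourier coefficient of $x$ at $g$ is $\widehat{x}(g):=\tau(\lambda_g^*x)$. *)

theory Defs
  imports "HOL-Analysis.Infinite_Sum" "HOL-Algebra.Group"
begin

text \<open>Vectors of \<open>\<ell>\<^sup>2(A)\<close> are functions on the whole type that vanish off \<open>A\<close>,
  so that equality of vectors is equality of functions.\<close>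

definition ell2 :: "'a set \<Rightarrow> ('a \<Rightarrow> complex) set" where
  "ell2 A = {f. (\<forall>x. x \<notin> A \<longrightarrow> f x = 0) \<and> (\<lambda>x. (cmod (f x))\<^sup>2) summable_on A}"

definition ell2_inner :: "'a set \<Rightarrow> ('a \<Rightarrow> complex) \<Rightarrow> ('a \<Rightarrow> complex) \<Rightarrow> complex" where
  "ell2_inner A f g = (\<Sum>\<^sub>\<infinity>x\<in>A. f x * cnj (g x))"

definition ell2_norm :: "'a set \<Rightarrow> ('a \<Rightarrow> complex) \<Rightarrow> real" where
  "ell2_norm A f = sqrt (\<Sum>\<^sub>\<infinity>x\<in>A. (cmod (f x))\<^sup>2)"

definition delta :: "'a \<Rightarrow> 'a \<Rightarrow> complex" where
  "delta a = (\<lambda>x. if x = a then 1 else 0)"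

type_synonym 'a ell2_op = "('a \<Rightarrow> complex) \<Rightarrow> ('a \<Rightarrow> complex)"

text \<open>\<open>B(\<ell>\<^sup>2(A))\<close>. Operators are extensional on \<open>ell2 A\<close>, so that equality of operators is
  equality of functions; accordingly products are formed with \<^const>\<open>compose\<close>
  and the identity operator is \<open>\<lambda>f\<in>ell2 A. f\<close>.\<close>

definition bounded_ops :: "'a set \<Rightarrow> 'a ell2_op set" where
  "bounded_ops A = {T \<in> ell2 A \<rightarrow>\<^sub>E ell2 A.
     (\<forall>f\<in>ell2 A. \<forall>g\<in>ell2 A. T (\<lambda>x. f x + g x) = (\<lambda>x. T f x + T g x)) \<and>
     (\<forall>c. \<forall>f\<in>ell2 A. T (\<lambda>x. c * f x) = (\<lambda>x. c * T f x)) \<and>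
     (\<exists>K. \<forall>f\<in>ell2 A. ell2_norm A (T f) \<le> K * ell2_norm A f)}"

definition op_mult :: "'a set \<Rightarrow> 'a ell2_op \<Rightarrow> 'a ell2_op \<Rightarrow> 'a ell2_op" where
  "op_mult A S T = compose (ell2 A) S T"

definition op_id :: "'a set \<Rightarrow> 'a ell2_op" where
  "op_id A = (\<lambda>f\<in>ell2 A. f)"

text \<open>Unique because elements of \<^term>\<open>bounded_ops A\<close> are extensional; it exists for every bounded
  \<open>T\<close> by the Riesz representation theorem.\<close>

definition op_adjoint :: "'a set \<Rightarrow> 'a ell2_op \<Rightarrow> 'a ell2_op" where
  "op_adjoint A T = (THE S. S \<in> bounded_ops A \<and>
     (\<forall>f\<in>ell2 A. \<forall>g\<in>ell2 A. ell2_inner A (T f) g = ell2_inner A f (S g)))"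

definition unitary_op :: "'a set \<Rightarrow> 'a ell2_op \<Rightarrow> bool" where
  "unitary_op A u \<longleftrightarrow> u \<in> bounded_ops A \<and>
     op_mult A (op_adjoint A u) u = op_id A \<and> op_mult A u (op_adjoint A u) = op_id A"

definition commutant :: "'a set \<Rightarrow> 'a ell2_op set \<Rightarrow> 'a ell2_op set" where
  "commutant A M = {T \<in> bounded_ops A. \<forall>S\<in>M. op_mult A T S = op_mult A S T}"

definition left_reg :: "('a, 'b) monoid_scheme \<Rightarrow> 'a \<Rightarrow> 'a ell2_op" where
  "left_reg G g = (\<lambda>f\<in>ell2 (carrier G).
     (\<lambda>x. if x \<in> carrier G then f (inv\<^bsub>G\<^esub> g \<otimes>\<^bsub>G\<^esub> x) else 0))"

definition group_vN :: "('a, 'b) monoid_scheme \<Rightarrow> 'a ell2_op set" where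
  "group_vN G = commutant (carrier G) (commutant (carrier G) (left_reg G ` carrier G))"

definition vN_trace :: "('a, 'b) monoid_scheme \<Rightarrow> 'a ell2_op \<Rightarrow> complex" where
  "vN_trace G x = ell2_inner (carrier G) (x (delta \<one>\<^bsub>G\<^esub>)) (delta \<one>\<^bsub>G\<^esub>)"

definition fourier_coeff :: "('a, 'b) monoid_scheme \<Rightarrow> 'a ell2_op \<Rightarrow> 'a \<Rightarrow> complex" where
  "fourier_coeff G x g =
     vN_trace G (op_mult (carrier G) (op_adjoint (carrier G) (left_reg G g)) x)"

end

theory Submission
  imports Defs "HOL-Analysis.Convex" "HOL-Algebra.Multiplicative_Group"
begin

text \<open>
  Multiplying a unitary \<open>v \<in> L(G)\<close> by \<open>\<lambda>\<^sub>c\<^sup>*\<close> translates its Fourier coefficients by \<open>c\<^sup>-\<^sup>1\<close>. Hence it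
  suffices to find a unitary with at least two nonzero coefficients and at least one vanishing
  coefficient (\<open>unitary_of_vanishing_coefficient\<close>). Such a unitary is found in the abelian
  subalgebra generated by \<open>\<lambda>\<^sub>a\<close>, for any \<open>a \<noteq> e\<close>; the construction depends on the order \<open>n\<close> of \<open>a\<close>.

  If \<open>n\<close> is infinite, functions of \<open>\<lambda>\<^sub>a\<close> are functions on the unit circle, and a Blaschke factor
  has modulus \<open>1\<close> there while its negative Fourier coefficients vanish. Up to a power of \<open>\<lambda>\<^sub>a\<close> it
  is \<open>b\<^sup>* b\<^sup>-\<^sup>1\<close> with \<open>b = 1 - r \<lambda>\<^sub>a\<close>, where \<open>b\<^sup>-\<^sup>1\<close> is the Neumann series
  (\<open>vanishing_coefficient_infinite_order\<close>).

  If \<open>4 \<le> n < \<infinity>\<close>, functions of \<open>\<lambda>\<^sub>a\<close> are functions on the \<open>n\<close>-th roots of unity. The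
  character \<open>z \<mapsto> z\<^sup>-\<^sup>1\<close> has mean \<open>0\<close>, and it keeps mean \<open>0\<close> and modulus \<open>1\<close> when two of its
  values are transposed, but it is then no longer a multiple of a character. The transposition is
  achieved by changing the phase on two eigenspaces of \<open>\<lambda>\<^sub>a\<close>
  (\<open>vanishing_coefficient_order_ge_4\<close>).

  If \<open>n\<close> is \<open>2\<close> or \<open>3\<close>, the powers of \<open>a\<close> do not exhaust \<open>G\<close> because \<open>G\<close> has at least four elements.
  So a coefficient off the cyclic subgroup vanishes, and changing the phase on one eigenspace
  produces two nonzero coefficients (\<open>vanishing_coefficient_outside_cyclic\<close>).
\<close>


section \<open>The Hilbert space of square-summable functions\<close>

abbreviation sq_norm :: "'a set \<Rightarrow> ('a \<Rightarrow> complex) \<Rightarrow> real" where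
  "sq_norm A f \<equiv> (\<Sum>\<^sub>\<infinity>x\<in>A. (cmod (f x))\<^sup>2)"

lemma ell2_summable: "f \<in> ell2 A \<Longrightarrow> (\<lambda>x. (cmod (f x))\<^sup>2) summable_on A"
  by (simp add: ell2_def)

lemma ell2_vanishes: "f \<in> ell2 A \<Longrightarrow> x \<notin> A \<Longrightarrow> f x = 0"
  by (simp add: ell2_def)

lemma sq_norm_nonneg: "0 \<le> sq_norm A f"
  by (simp add: infsum_nonneg)

lemma cmod_sq_le_sq_norm:
  assumes "f \<in> ell2 A" "x \<in> A"
  shows "(cmod (f x))\<^sup>2 \<le> sq_norm A f"
  using finite_sum_le_infsum[OF ell2_summable[OF assms(1)], of "{x}"] assms(2) by simp

lemma cmod_sq_lincomb_le:
  "(cmod (c * a + d * b))\<^sup>2 \<le> 2 * (cmod c)\<^sup>2 * (cmod a)\<^sup>2 + 2 * (cmod d)\<^sup>2 * (cmod b)\<^sup>2"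
proof -
  have "(cmod (c * a + d * b))\<^sup>2 \<le> (cmod (c * a) + cmod (d * b))\<^sup>2"
    by (intro power_mono norm_triangle_ineq) simp
  also have "\<dots> \<le> 2 * (cmod (c * a))\<^sup>2 + 2 * (cmod (d * b))\<^sup>2"
    using sum_squares_bound[of "cmod (c * a)" "cmod (d * b)"] by (simp add: power2_sum)
  finally show ?thesis by (simp add: norm_mult power_mult_distrib mult.assoc)
qed

lemma ell2_lincomb:
  assumes "f \<in> ell2 A" "g \<in> ell2 A"
  shows "(\<lambda>x. c * f x + d * g x) \<in> ell2 A"
    and "sq_norm A (\<lambda>x. c * f x + d * g x)
      \<le> 2 * (cmod c)\<^sup>2 * sq_norm A f + 2 * (cmod d)\<^sup>2 * sq_norm A g"
proof -
  let ?h = "\<lambda>x. 2 * (cmod c)\<^sup>2 * (cmod (f x))\<^sup>2 + 2 * (cmod d)\<^sup>2 * (cmod (g x))\<^sup>2"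
  have sf: "(\<lambda>x. 2 * (cmod c)\<^sup>2 * (cmod (f x))\<^sup>2) summable_on A"
    and sg: "(\<lambda>x. 2 * (cmod d)\<^sup>2 * (cmod (g x))\<^sup>2) summable_on A"
    by (intro summable_on_cmult_right ell2_summable assms)+
  note sh = summable_on_add[OF sf sg]
  have s: "(\<lambda>x. (cmod (c * f x + d * g x))\<^sup>2) summable_on A"
    by (rule summable_on_comparison_test[OF sh]) (auto simp: cmod_sq_lincomb_le)
  then show "(\<lambda>x. c * f x + d * g x) \<in> ell2 A"
    using assms by (simp add: ell2_def)
  have "sq_norm A (\<lambda>x. c * f x + d * g x) \<le> infsum ?h A"
    by (rule infsum_mono[OF s sh]) (rule cmod_sq_lincomb_le)
  also have "\<dots> = 2 * (cmod c)\<^sup>2 * sq_norm A f + 2 * (cmod d)\<^sup>2 * sq_norm A g"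
    by (simp add: infsum_add[OF sf sg] infsum_cmult_right')
  finally show "sq_norm A (\<lambda>x. c * f x + d * g x)
      \<le> 2 * (cmod c)\<^sup>2 * sq_norm A f + 2 * (cmod d)\<^sup>2 * sq_norm A g" .
qed

lemma delta_in_ell2: "a \<in> A \<Longrightarrow> delta a \<in> ell2 A"
proof -
  assume a: "a \<in> A"
  have "(\<lambda>x. (cmod (delta a x))\<^sup>2) summable_on A \<longleftrightarrow> (\<lambda>x. (cmod (delta a x))\<^sup>2) summable_on {a}"
    using a by (intro summable_on_cong_neutral) (auto simp: delta_def)
  then show ?thesis using a by (auto simp: ell2_def delta_def)
qed

lemma ell2_inner_summable:
  assumes "f \<in> ell2 A" "g \<in> ell2 A"
  shows "(\<lambda>x. f x * cnj (g x)) summable_on A"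
proof (rule abs_summable_summable, rule abs_summable_on_comparison_test')
  show "(\<lambda>x. (cmod (f x))\<^sup>2 + (cmod (g x))\<^sup>2) summable_on A"
    by (intro summable_on_add ell2_summable assms)
  show "cmod (f x * cnj (g x)) \<le> (cmod (f x))\<^sup>2 + (cmod (g x))\<^sup>2" for x
  proof -
    have "2 * (cmod (f x) * cmod (g x)) \<le> (cmod (f x))\<^sup>2 + (cmod (g x))\<^sup>2"
      using sum_squares_bound[of "cmod (f x)" "cmod (g x)"] by simp
    moreover have "0 \<le> cmod (f x) * cmod (g x)" by simp
    ultimately have "cmod (f x) * cmod (g x) \<le> (cmod (f x))\<^sup>2 + (cmod (g x))\<^sup>2" by linarith
    then show ?thesis by (simp add: norm_mult)
  qed
qed

lemma ell2_inner_commute: "ell2_inner A f g = cnj (ell2_inner A g f)"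
  unfolding ell2_inner_def by (subst infsum_cnj[symmetric]) (simp add: mult.commute)

lemma ell2_inner_lincomb_left:
  assumes "f \<in> ell2 A" "g \<in> ell2 A" "h \<in> ell2 A"
  shows "ell2_inner A (\<lambda>x. c * f x + d * g x) h = c * ell2_inner A f h + d * ell2_inner A g h"
proof -
  have "(\<lambda>x. c * (f x * cnj (h x))) summable_on A" "(\<lambda>x. d * (g x * cnj (h x))) summable_on A"
    by (intro summable_on_cmult_right ell2_inner_summable assms)+
  then show ?thesis
    unfolding ell2_inner_def
    by (simp add: ring_distribs mult.assoc infsum_add infsum_cmult_right')
qed

lemma ell2_inner_lincomb_right:
  assumes "f \<in> ell2 A" "g \<in> ell2 A" "h \<in> ell2 A"
  shows "ell2_inner A h (\<lambda>x. c * f x + d * g x)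
    = cnj c * ell2_inner A h f + cnj d * ell2_inner A h g"
  unfolding ell2_inner_commute[of A h] ell2_inner_lincomb_left[OF assms] by simp

lemma ell2_inner_delta_right:
  assumes "a \<in> A"
  shows "ell2_inner A f (delta a) = f a"
proof -
  have "ell2_inner A f (delta a) = infsum (\<lambda>x. f x * cnj (delta a x)) {a}"
    unfolding ell2_inner_def
    using assms by (intro infsum_cong_neutral) (auto simp: delta_def)
  then show ?thesis by (simp add: delta_def)
qed

text \<open>A vector of \<open>\<ell>\<^sup>2(A)\<close> is determined by its inner products with the basis vectors
  \<open>\<delta>\<^sub>a\<close>; this is what makes adjoints unique.\<close>

lemma ell2_eqI:
  assumes "f \<in> ell2 A" "g \<in> ell2 A"
    and "\<And>h. h \<in> ell2 A \<Longrightarrow> ell2_inner A h f = ell2_inner A h g"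
  shows "f = g"
proof
  fix x
  show "f x = g x"
  proof (cases "x \<in> A")
    case True
    then have "ell2_inner A (delta x) f = ell2_inner A (delta x) g"
      by (intro assms(3) delta_in_ell2)
    then have "ell2_inner A f (delta x) = ell2_inner A g (delta x)"
      by (metis ell2_inner_commute)
    then show ?thesis using True by (simp add: ell2_inner_delta_right)
  qed (use assms ell2_vanishes in metis)
qed


section \<open>Bounded operators, commutants and adjoints\<close>

text \<open>Boundedness may be checked on squared norms, where the pointwise bound
  \<open>\<bar>s + t\<bar>\<^sup>2 \<le> 2\<bar>s\<bar>\<^sup>2 + 2\<bar>t\<bar>\<^sup>2\<close> takes the place of the Minkowski inequality.\<close>

lemma bounded_opsI:
  assumes "T \<in> ell2 A \<rightarrow>\<^sub>E ell2 A"
    and lin: "\<And>c d f g. f \<in> ell2 A \<Longrightarrow> g \<in> ell2 A \<Longrightarrow>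
      T (\<lambda>x. c * f x + d * g x) = (\<lambda>x. c * T f x + d * T g x)"
    and bd: "\<And>f. f \<in> ell2 A \<Longrightarrow> sq_norm A (T f) \<le> K * sq_norm A f"
  shows "T \<in> bounded_ops A"
proof -
  have "\<exists>K. \<forall>f\<in>ell2 A. ell2_norm A (T f) \<le> K * ell2_norm A f"
    using bd by (auto simp: ell2_norm_def real_sqrt_mult[symmetric] intro!: exI[of _ "sqrt K"])
  moreover have "T (\<lambda>x. f x + g x) = (\<lambda>x. T f x + T g x)" if "f \<in> ell2 A" "g \<in> ell2 A" for f g
    using lin[OF that, of 1 1] by simp
  moreover have "T (\<lambda>x. c * f x) = (\<lambda>x. c * T f x)" if "f \<in> ell2 A" for c f
    using lin[OF that that, of c 0] by simp
  ultimately show ?thesis using assms(1) by (simp add: bounded_ops_def)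
qed

lemma bounded_ops_closed: "T \<in> bounded_ops A \<Longrightarrow> f \<in> ell2 A \<Longrightarrow> T f \<in> ell2 A"
  by (auto simp: bounded_ops_def)

lemma bounded_ops_extensional: "T \<in> bounded_ops A \<Longrightarrow> f \<notin> ell2 A \<Longrightarrow> T f = undefined"
  by (auto simp: bounded_ops_def PiE_def extensional_def)

lemma bounded_ops_lincomb:
  assumes T: "T \<in> bounded_ops A" and f: "f \<in> ell2 A" and g: "g \<in> ell2 A"
  shows "T (\<lambda>x. c * f x + d * g x) = (\<lambda>x. c * T f x + d * T g x)"
proof -
  have "(\<lambda>x. c * f x) \<in> ell2 A" "(\<lambda>x. d * g x) \<in> ell2 A"
    using ell2_lincomb(1)[OF f f, of c 0] ell2_lincomb(1)[OF g g, of d 0] by simp_all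
  then show ?thesis using T f g by (simp add: bounded_ops_def)
qed

lemma bounded_ops_bound:
  assumes "T \<in> bounded_ops A"
  obtains K where "0 \<le> K" "\<And>f. f \<in> ell2 A \<Longrightarrow> sq_norm A (T f) \<le> K * sq_norm A f"
proof -
  obtain K where K: "\<And>f. f \<in> ell2 A \<Longrightarrow> ell2_norm A (T f) \<le> K * ell2_norm A f"
    using assms unfolding bounded_ops_def by blast
  have "sq_norm A (T f) \<le> K\<^sup>2 * sq_norm A f" if "f \<in> ell2 A" for f
  proof -
    have "(ell2_norm A (T f))\<^sup>2 \<le> (K * ell2_norm A f)\<^sup>2"
      using K[OF that] by (intro power_mono) (auto simp: ell2_norm_def sq_norm_nonneg)
    then show ?thesis by (simp add: ell2_norm_def power_mult_distrib sq_norm_nonneg)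
  qed
  then show thesis by (intro that[of "K\<^sup>2"]) auto
qed

definition op_comb :: "'a set \<Rightarrow> complex \<Rightarrow> 'a ell2_op \<Rightarrow> complex \<Rightarrow> 'a ell2_op \<Rightarrow> 'a ell2_op" where
  "op_comb A c S d T = (\<lambda>f\<in>ell2 A. (\<lambda>x. c * S f x + d * T f x))"

lemma op_comb_apply: "f \<in> ell2 A \<Longrightarrow> op_comb A c S d T f = (\<lambda>x. c * S f x + d * T f x)"
  by (simp add: op_comb_def)

lemma op_mult_apply: "f \<in> ell2 A \<Longrightarrow> op_mult A S T f = S (T f)"
  by (simp add: op_mult_def compose_def)

lemma op_comb_bounded:
  assumes S: "S \<in> bounded_ops A" and T: "T \<in> bounded_ops A"
  shows "op_comb A c S d T \<in> bounded_ops A"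
proof -
  obtain K L where K: "\<And>f. f \<in> ell2 A \<Longrightarrow> sq_norm A (S f) \<le> K * sq_norm A f"
    and L: "\<And>f. f \<in> ell2 A \<Longrightarrow> sq_norm A (T f) \<le> L * sq_norm A f"
    using bounded_ops_bound[OF S] bounded_ops_bound[OF T] by metis
  have bd: "sq_norm A (op_comb A c S d T f)
      \<le> (2 * (cmod c)\<^sup>2 * K + 2 * (cmod d)\<^sup>2 * L) * sq_norm A f" if f: "f \<in> ell2 A" for f
  proof -
    have "sq_norm A (op_comb A c S d T f)
        \<le> 2 * (cmod c)\<^sup>2 * sq_norm A (S f) + 2 * (cmod d)\<^sup>2 * sq_norm A (T f)"
      unfolding op_comb_apply[OF f]
      by (intro ell2_lincomb bounded_ops_closed[OF S] bounded_ops_closed[OF T] f)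
    also have "\<dots> \<le> 2 * (cmod c)\<^sup>2 * (K * sq_norm A f) + 2 * (cmod d)\<^sup>2 * (L * sq_norm A f)"
      using K[OF f] L[OF f] by (intro add_mono mult_left_mono) auto
    finally show ?thesis by (simp add: algebra_simps)
  qed
  show ?thesis
  proof (rule bounded_opsI[OF _ _ bd])
    show "op_comb A c S d T \<in> ell2 A \<rightarrow>\<^sub>E ell2 A"
      by (auto simp: op_comb_def intro!: ell2_lincomb bounded_ops_closed[OF S] bounded_ops_closed[OF T])
    show "op_comb A c S d T (\<lambda>x. a * f x + b * g x)
      = (\<lambda>x. a * op_comb A c S d T f x + b * op_comb A c S d T g x)"
      if "f \<in> ell2 A" "g \<in> ell2 A" for a b f g
      using that
      by (simp add: op_comb_apply ell2_lincomb bounded_ops_lincomb[OF S] bounded_ops_lincomb[OF T]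
        algebra_simps)
  qed
qed

lemma op_mult_bounded:
  assumes S: "S \<in> bounded_ops A" and T: "T \<in> bounded_ops A"
  shows "op_mult A S T \<in> bounded_ops A"
proof -
  obtain K L where K0: "0 \<le> K" and K: "\<And>f. f \<in> ell2 A \<Longrightarrow> sq_norm A (S f) \<le> K * sq_norm A f"
    and L: "\<And>f. f \<in> ell2 A \<Longrightarrow> sq_norm A (T f) \<le> L * sq_norm A f"
    using bounded_ops_bound[OF S] bounded_ops_bound[OF T] by metis
  note cl = bounded_ops_closed[OF S] bounded_ops_closed[OF T]
  have bd: "sq_norm A (op_mult A S T f) \<le> (K * L) * sq_norm A f" if f: "f \<in> ell2 A" for f
    using K[OF cl(2)[OF f]] mult_left_mono[OF L[OF f] K0] by (simp add: op_mult_apply f)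
  show ?thesis
  proof (rule bounded_opsI[OF _ _ bd])
    show "op_mult A S T \<in> ell2 A \<rightarrow>\<^sub>E ell2 A"
      by (auto simp: op_mult_def compose_def intro!: cl)
  qed (simp add: op_mult_apply ell2_lincomb bounded_ops_lincomb[OF S] bounded_ops_lincomb[OF T] cl)
qed

lemma op_id_bounded: "op_id A \<in> bounded_ops A"
  by (rule bounded_opsI[where K = 1]) (auto simp: op_id_def ell2_lincomb)

text \<open>The operators are extensional, so commuting is the same as commuting on vectors.\<close>

lemma mem_commutant_iff:
  "T \<in> commutant A X \<longleftrightarrow> T \<in> bounded_ops A \<and> (\<forall>S\<in>X. \<forall>f\<in>ell2 A. T (S f) = S (T f))"
  by (auto simp: commutant_def op_mult_def compose_def restrict_def fun_eq_iff)

lemma op_comb_commutant: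
  assumes "X \<subseteq> bounded_ops A" "S \<in> commutant A X" "T \<in> commutant A X"
  shows "op_comb A c S d T \<in> commutant A X"
  using assms
  by (auto simp: mem_commutant_iff op_comb_bounded op_comb_apply subset_iff bounded_ops_closed
      bounded_ops_lincomb)

lemma op_mult_commutant:
  assumes "X \<subseteq> bounded_ops A" "S \<in> commutant A X" "T \<in> commutant A X"
  shows "op_mult A S T \<in> commutant A X"
  using assms
  by (auto simp: mem_commutant_iff op_mult_bounded op_mult_apply subset_iff bounded_ops_closed)

lemma op_id_commutant: "X \<subseteq> bounded_ops A \<Longrightarrow> op_id A \<in> commutant A X"
  by (auto simp: mem_commutant_iff op_id_bounded) (auto simp: op_id_def dest: bounded_ops_closed)

text \<open>Adjoints are carried along with the operators: every operator that occurs comes with an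
  explicit adjoint in \<open>M\<close>, which replaces the existence of adjoints (the Riesz representation
  theorem) and the closure of \<open>M\<close> under them.\<close>

definition adjoint_pair :: "'a set \<Rightarrow> 'a ell2_op set \<Rightarrow> 'a ell2_op \<Rightarrow> 'a ell2_op \<Rightarrow> bool" where
  "adjoint_pair A M S T \<longleftrightarrow> S \<in> M \<and> T \<in> M \<and>
     (\<forall>f\<in>ell2 A. \<forall>g\<in>ell2 A. ell2_inner A (S f) g = ell2_inner A f (T g))"

lemma adjoint_pair_bounded:
  assumes "adjoint_pair A (commutant A X) S T"
  shows "S \<in> bounded_ops A" "T \<in> bounded_ops A"
  using assms by (auto simp: adjoint_pair_def mem_commutant_iff)

lemma adjoint_pair_sym: "adjoint_pair A M S T \<Longrightarrow> adjoint_pair A M T S"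
  unfolding adjoint_pair_def by (metis ell2_inner_commute)

lemma op_adjoint_eq:
  assumes "adjoint_pair A M S T" "M \<subseteq> bounded_ops A"
  shows "op_adjoint A S = T"
  unfolding op_adjoint_def
proof (rule the_equality)
  show "T \<in> bounded_ops A \<and>
     (\<forall>f\<in>ell2 A. \<forall>g\<in>ell2 A. ell2_inner A (S f) g = ell2_inner A f (T g))"
    using assms by (auto simp: adjoint_pair_def)
  fix T' assume T': "T' \<in> bounded_ops A \<and>
     (\<forall>f\<in>ell2 A. \<forall>g\<in>ell2 A. ell2_inner A (S f) g = ell2_inner A f (T' g))"
  have T: "T \<in> bounded_ops A" using assms by (auto simp: adjoint_pair_def)
  show "T' = T"
  proof
    fix g
    show "T' g = T g"
    proof (cases "g \<in> ell2 A")
      case True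
      show ?thesis
      proof (rule ell2_eqI)
        show "T' g \<in> ell2 A" "T g \<in> ell2 A" using T' T True by (auto intro: bounded_ops_closed)
        show "ell2_inner A h (T' g) = ell2_inner A h (T g)" if "h \<in> ell2 A" for h
          using T' assms(1) True that by (auto simp: adjoint_pair_def)
      qed
    qed (use T T' bounded_ops_extensional in metis)
  qed
qed

lemma adjoint_pair_comb:
  assumes X: "X \<subseteq> bounded_ops A"
    and 1: "adjoint_pair A (commutant A X) S T" and 2: "adjoint_pair A (commutant A X) S' T'"
  shows "adjoint_pair A (commutant A X) (op_comb A c S d S') (op_comb A (cnj c) T (cnj d) T')"
  using assms adjoint_pair_bounded[OF 1] adjoint_pair_bounded[OF 2]
  by (auto simp: adjoint_pair_def op_comb_commutant op_comb_apply ell2_inner_lincomb_left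
    ell2_inner_lincomb_right bounded_ops_closed)

lemma adjoint_pair_mult:
  assumes X: "X \<subseteq> bounded_ops A"
    and 1: "adjoint_pair A (commutant A X) S T" and 2: "adjoint_pair A (commutant A X) S' T'"
  shows "adjoint_pair A (commutant A X) (op_mult A S S') (op_mult A T' T)"
  using assms adjoint_pair_bounded[OF 1] adjoint_pair_bounded[OF 2]
  by (auto simp: adjoint_pair_def op_mult_commutant op_mult_apply bounded_ops_closed)

lemma adjoint_pair_id: "X \<subseteq> bounded_ops A \<Longrightarrow> adjoint_pair A (commutant A X) (op_id A) (op_id A)"
  by (auto simp: adjoint_pair_def op_id_commutant) (simp add: op_id_def)

text \<open>An operator that commutes with \<open>S\<close> commutes with \<open>S\<^sup>-\<^sup>1\<close>, and the inverse of a linear bijection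
  is linear; so only boundedness has to be supplied. This puts an infinite series into the
  commutant without a limit argument.\<close>

lemma inverse_commutant:
  assumes X: "X \<subseteq> bounded_ops A" and S: "S \<in> commutant A X"
    and R: "R \<in> ell2 A \<rightarrow>\<^sub>E ell2 A"
    and SR: "\<And>f. f \<in> ell2 A \<Longrightarrow> S (R f) = f" and RS: "\<And>f. f \<in> ell2 A \<Longrightarrow> R (S f) = f"
    and bd: "\<And>f. f \<in> ell2 A \<Longrightarrow> sq_norm A (R f) \<le> K * sq_norm A f"
  shows "R \<in> commutant A X"
proof -
  have Sb: "S \<in> bounded_ops A" using S by (simp add: mem_commutant_iff)
  have Rc: "R f \<in> ell2 A" if "f \<in> ell2 A" for f using R that by auto
  have Rb: "R \<in> bounded_ops A"
  proof (rule bounded_opsI[OF R _ bd])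
    fix c d f g assume f: "f \<in> ell2 A" and g: "g \<in> ell2 A"
    have "R (\<lambda>x. c * f x + d * g x) = R (\<lambda>x. c * S (R f) x + d * S (R g) x)"
      by (simp add: SR f g)
    also have "\<dots> = R (S (\<lambda>x. c * R f x + d * R g x))"
      by (simp add: bounded_ops_lincomb[OF Sb] Rc f g)
    also have "\<dots> = (\<lambda>x. c * R f x + d * R g x)"
      by (intro RS ell2_lincomb Rc f g)
    finally show "R (\<lambda>x. c * f x + d * g x) = (\<lambda>x. c * R f x + d * R g x)" .
  qed
  moreover have "R (T f) = T (R f)" if T: "T \<in> X" and f: "f \<in> ell2 A" for T f
  proof -
    have Tc: "T h \<in> ell2 A" if "h \<in> ell2 A" for h using X T that bounded_ops_closed by blast
    have "R (T f) = R (T (S (R f)))" by (simp add: SR f)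
    also have "\<dots> = R (S (T (R f)))" using S T Rc[OF f] by (simp add: mem_commutant_iff)
    also have "\<dots> = T (R f)" by (intro RS Tc Rc f)
    finally show ?thesis .
  qed
  ultimately show ?thesis by (simp add: mem_commutant_iff)
qed

lemma adjoint_pair_inverse:
  assumes 1: "adjoint_pair A (commutant A X) S T"
    and R: "R \<in> commutant A X" "\<And>f. f \<in> ell2 A \<Longrightarrow> S (R f) = f"
    and Q: "Q \<in> commutant A X" "\<And>f. f \<in> ell2 A \<Longrightarrow> T (Q f) = f"
  shows "adjoint_pair A (commutant A X) R Q"
proof -
  have "ell2_inner A (R f) g = ell2_inner A f (Q g)" if f: "f \<in> ell2 A" and g: "g \<in> ell2 A" for f g
  proof -
    have c: "R f \<in> ell2 A" "Q g \<in> ell2 A"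
      using R(1) Q(1) f g by (auto simp: mem_commutant_iff bounded_ops_closed)
    have "ell2_inner A (R f) g = ell2_inner A (R f) (T (Q g))" by (simp add: Q(2) g)
    also have "\<dots> = ell2_inner A (S (R f)) (Q g)" using 1 c by (simp add: adjoint_pair_def)
    finally show ?thesis by (simp add: R(2) f)
  qed
  then show ?thesis using R(1) Q(1) by (simp add: adjoint_pair_def)
qed

definition unitary_pair :: "'a set \<Rightarrow> 'a ell2_op set \<Rightarrow> 'a ell2_op \<Rightarrow> 'a ell2_op \<Rightarrow> bool" where
  "unitary_pair A M u v \<longleftrightarrow> adjoint_pair A M u v \<and>
     (\<forall>f\<in>ell2 A. u (v f) = f) \<and> (\<forall>f\<in>ell2 A. v (u f) = f)"

lemma unitary_pair_imp_unitary:
  assumes "unitary_pair A M u v" "M \<subseteq> bounded_ops A"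
  shows "unitary_op A u"
proof -
  have "op_adjoint A u = v" "u \<in> bounded_ops A"
    using assms op_adjoint_eq[of A M u v] by (auto simp: unitary_pair_def adjoint_pair_def)
  then show ?thesis
    using assms(1)
    by (auto simp: unitary_op_def unitary_pair_def op_mult_def op_id_def compose_def restrict_def)
qed

lemma unitary_pair_mult:
  assumes X: "X \<subseteq> bounded_ops A"
    and 1: "unitary_pair A (commutant A X) u v" and 2: "unitary_pair A (commutant A X) u' v'"
  shows "unitary_pair A (commutant A X) (op_mult A u u') (op_mult A v' v)"
proof -
  have "u \<in> bounded_ops A" "v \<in> bounded_ops A" "u' \<in> bounded_ops A" "v' \<in> bounded_ops A"
    using 1 2 adjoint_pair_bounded by (auto simp: unitary_pair_def)
  then show ?thesis
    using 1 2 by (auto simp: unitary_pair_def adjoint_pair_mult[OF X] op_mult_apply bounded_ops_closed)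
qed

text \<open>For a projection \<open>p\<close> and \<open>\<bar>\<alpha>\<bar> = 1\<close> the operator \<open>1 + (\<alpha> - 1) p\<close> multiplies the range
  of \<open>p\<close> by the phase \<open>\<alpha>\<close> and fixes its orthogonal complement.\<close>

lemma unitary_pair_phase:
  assumes X: "X \<subseteq> bounded_ops A"
    and P: "adjoint_pair A (commutant A X) p p" and idem: "\<And>f. f \<in> ell2 A \<Longrightarrow> p (p f) = p f"
    and \<alpha>: "cmod \<alpha> = 1"
  shows "unitary_pair A (commutant A X)
    (op_comb A 1 (op_id A) (\<alpha> - 1) p) (op_comb A 1 (op_id A) (cnj \<alpha> - 1) p)"
proof -
  have pb: "p \<in> bounded_ops A" by (rule adjoint_pair_bounded[OF P])
  have *: "op_comb A 1 (op_id A) (\<beta> - 1) p (op_comb A 1 (op_id A) (\<gamma> - 1) p f) = f"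
    if f: "f \<in> ell2 A" and \<beta>\<gamma>: "\<beta> * \<gamma> = 1" for f \<beta> \<gamma>
  proof -
    have pf: "p f \<in> ell2 A" by (rule bounded_ops_closed[OF pb f])
    note lc = ell2_lincomb(1)[OF f pf, of 1 "\<gamma> - 1", simplified]
    have "p (\<lambda>x. f x + (\<gamma> - 1) * p f x) = (\<lambda>x. p f x + (\<gamma> - 1) * p f x)"
      using bounded_ops_lincomb[OF pb f pf, of 1 "\<gamma> - 1"] by (simp add: idem f)
    moreover have "(\<lambda>x. f x + (\<gamma> - 1) * p f x + (\<beta> - 1) * (p f x + (\<gamma> - 1) * p f x)) = f"
    proof
      fix x
      have "f x + (\<gamma> - 1) * p f x + (\<beta> - 1) * (p f x + (\<gamma> - 1) * p f x)
        = f x + (\<beta> * \<gamma> - 1) * p f x" by (simp add: algebra_simps)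
      then show "f x + (\<gamma> - 1) * p f x + (\<beta> - 1) * (p f x + (\<gamma> - 1) * p f x) = f x"
        by (simp add: \<beta>\<gamma>)
    qed
    ultimately show ?thesis by (simp add: op_comb_apply op_id_def f lc)
  qed
  have "\<alpha> * cnj \<alpha> = 1" using \<alpha> by (simp add: complex_norm_square[symmetric])
  moreover have "adjoint_pair A (commutant A X)
    (op_comb A 1 (op_id A) (\<alpha> - 1) p) (op_comb A 1 (op_id A) (cnj \<alpha> - 1) p)"
    using adjoint_pair_comb[OF X adjoint_pair_id[OF X] P, of 1 "\<alpha> - 1"] by simp
  ultimately show ?thesis using * by (auto simp: unitary_pair_def mult.commute)
qed

text \<open>In a commutative algebra this is the remark that \<open>\<bar>cnj z / z\<bar> = 1\<close>; normality of \<open>b\<close> lets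
  \<open>b\<close>, \<open>b\<^sup>*\<close> and their inverses \<open>r\<close>, \<open>r'\<close> be permuted in the same way.\<close>

lemma unitary_pair_normal:
  assumes X: "X \<subseteq> bounded_ops A"
    and B: "adjoint_pair A (commutant A X) b b'" and R: "adjoint_pair A (commutant A X) r r'"
    and normal: "\<And>f. f \<in> ell2 A \<Longrightarrow> b (b' f) = b' (b f)"
    and br: "\<And>f. f \<in> ell2 A \<Longrightarrow> b (r f) = f" "\<And>f. f \<in> ell2 A \<Longrightarrow> r (b f) = f"
    and br': "\<And>f. f \<in> ell2 A \<Longrightarrow> b' (r' f) = f" "\<And>f. f \<in> ell2 A \<Longrightarrow> r' (b' f) = f"
  shows "unitary_pair A (commutant A X) (op_mult A b' r) (op_mult A r' b)"
proof -
  note cl = adjoint_pair_bounded[OF B, THEN bounded_ops_closed]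
    adjoint_pair_bounded[OF R, THEN bounded_ops_closed]
  have "r' (b f) = b (r' f)" if "f \<in> ell2 A" for f
    using normal[of "r' f"] br' that by (metis cl)
  then have "b' (r (r' (b f))) = f" "r' (b (b' (r f))) = f" if "f \<in> ell2 A" for f
    using that by (simp_all add: normal br br' cl)
  then show ?thesis
    using adjoint_pair_mult[OF X adjoint_pair_sym[OF B] R]
    by (simp add: unitary_pair_def op_mult_apply cl)
qed

lemma adjoint_pair_sum:
  fixes n :: nat
  assumes X: "X \<subseteq> bounded_ops A"
    and S: "\<And>k. k < n \<Longrightarrow> adjoint_pair A (commutant A X) (S k) (T k)"
  shows "adjoint_pair A (commutant A X) (\<lambda>f\<in>ell2 A. (\<lambda>x. \<Sum>k<n. c k * S k f x))
    (\<lambda>f\<in>ell2 A. (\<lambda>x. \<Sum>k<n. cnj (c k) * T k f x))"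
  using S
proof (induction n)
  case 0
  show ?case
    using adjoint_pair_comb[OF X adjoint_pair_id[OF X] adjoint_pair_id[OF X], of 0 0]
    by (simp add: op_comb_def restrict_def)
next
  case (Suc n)
  have "adjoint_pair A (commutant A X) (\<lambda>f\<in>ell2 A. (\<lambda>x. \<Sum>k<n. c k * S k f x))
    (\<lambda>f\<in>ell2 A. (\<lambda>x. \<Sum>k<n. cnj (c k) * T k f x))"
    by (rule Suc.IH) (simp add: Suc.prems)
  from adjoint_pair_comb[OF X this Suc.prems[of n], of 1 "c n"]
  show ?case by (simp add: op_comb_def restrict_def cong: if_cong)
qed


section \<open>The group von Neumann algebra\<close>

context group
begin

lemma left_reg_apply:
  "f \<in> ell2 (carrier G) \<Longrightarrow> left_reg G g f = (\<lambda>x. if x \<in> carrier G then f (inv g \<otimes> x) else 0)"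
  by (simp add: left_reg_def)

lemma bij_betw_translation: "g \<in> carrier G \<Longrightarrow> bij_betw (\<lambda>x. g \<otimes> x) (carrier G) (carrier G)"
  by (rule bij_betw_byWitness[where f' = "\<lambda>x. inv g \<otimes> x"]) (auto simp: m_assoc[symmetric])

lemma left_reg_ell2:
  assumes g: "g \<in> carrier G" and f: "f \<in> ell2 (carrier G)"
  shows "left_reg G g f \<in> ell2 (carrier G)"
    and "sq_norm (carrier G) (left_reg G g f) = sq_norm (carrier G) f"
proof -
  note bij = bij_betw_translation[OF inv_closed[OF g]]
  have "(\<lambda>x. (cmod (f (inv g \<otimes> x)))\<^sup>2) summable_on carrier G"
    using summable_on_reindex_bij_betw[OF bij, of "\<lambda>x. (cmod (f x))\<^sup>2"] ell2_summable[OF f] by simp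
  then have "(\<lambda>x. (cmod (left_reg G g f x))\<^sup>2) summable_on carrier G"
    by (rule summable_on_cong[THEN iffD1, rotated]) (simp add: left_reg_apply f)
  then show "left_reg G g f \<in> ell2 (carrier G)"
    by (subst ell2_def) (simp add: left_reg_apply f)
  have "sq_norm (carrier G) (left_reg G g f) = (\<Sum>\<^sub>\<infinity>x\<in>carrier G. (cmod (f (inv g \<otimes> x)))\<^sup>2)"
    by (intro infsum_cong) (simp add: left_reg_apply f)
  also have "\<dots> = sq_norm (carrier G) f"
    by (rule infsum_reindex_bij_betw[OF bij, of "\<lambda>x. (cmod (f x))\<^sup>2"])
  finally show "sq_norm (carrier G) (left_reg G g f) = sq_norm (carrier G) f" .
qed

lemma left_reg_bounded: "g \<in> carrier G \<Longrightarrow> left_reg G g \<in> bounded_ops (carrier G)"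
proof (rule bounded_opsI[where K = 1])
  assume g: "g \<in> carrier G"
  show "left_reg G g \<in> ell2 (carrier G) \<rightarrow>\<^sub>E ell2 (carrier G)"
    using left_reg_ell2(1)[OF g] by (auto simp: left_reg_def)
  show "sq_norm (carrier G) (left_reg G g f) \<le> 1 * sq_norm (carrier G) f"
    if "f \<in> ell2 (carrier G)" for f
    by (simp add: left_reg_ell2(2)[OF g that])
qed (auto simp: left_reg_apply ell2_lincomb fun_eq_iff)

lemma left_reg_mult:
  assumes "g \<in> carrier G" "h \<in> carrier G" "f \<in> ell2 (carrier G)"
  shows "left_reg G g (left_reg G h f) = left_reg G (g \<otimes> h) f"
  using assms left_reg_apply[OF left_reg_ell2(1)[OF assms(2,3)], of g]
  by (auto simp: left_reg_apply inv_mult_group m_assoc)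

lemma left_reg_one: "f \<in> ell2 (carrier G) \<Longrightarrow> left_reg G \<one> f = f"
  by (auto simp: left_reg_apply ell2_vanishes)

lemma left_reg_delta:
  assumes "g \<in> carrier G" "a \<in> carrier G"
  shows "left_reg G g (delta a) = delta (g \<otimes> a)"
proof -
  have "inv g \<otimes> x = a \<longleftrightarrow> x = g \<otimes> a" if "x \<in> carrier G" for x
    using assms that by (metis inv_closed inv_solve_left inv_solve_left')
  then show ?thesis
    using assms by (auto simp: left_reg_apply delta_in_ell2 fun_eq_iff) (auto simp: delta_def)
qed

lemma left_reg_inner:
  assumes g: "g \<in> carrier G" and f: "f \<in> ell2 (carrier G)" and h: "h \<in> ell2 (carrier G)"
  shows "ell2_inner (carrier G) (left_reg G g f) h = ell2_inner (carrier G) f (left_reg G (inv g) h)"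
proof -
  have "ell2_inner (carrier G) (left_reg G g f) h
      = (\<Sum>\<^sub>\<infinity>x\<in>carrier G. (\<lambda>y. f y * cnj (h (g \<otimes> y))) (inv g \<otimes> x))"
    unfolding ell2_inner_def using g
    by (intro infsum_cong) (simp add: left_reg_apply f m_assoc[symmetric])
  also have "\<dots> = (\<Sum>\<^sub>\<infinity>y\<in>carrier G. f y * cnj (h (g \<otimes> y)))"
    by (rule infsum_reindex_bij_betw[OF bij_betw_translation[OF inv_closed[OF g]]])
  also have "\<dots> = ell2_inner (carrier G) f (left_reg G (inv g) h)"
    unfolding ell2_inner_def using g by (intro infsum_cong) (simp add: left_reg_apply h)
  finally show ?thesis .
qed

lemma commutant_subset_bounded: "commutant A X \<subseteq> bounded_ops A"
  by (auto simp: mem_commutant_iff)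

text \<open>Since \<open>L(G)\<close> is a bicommutant, it is the commutant of a set of bounded operators, and the
  closure properties above specialise to it.\<close>

lemmas vN_adjoint_pair_bounded = adjoint_pair_bounded[where A = "carrier G" and
    X = "commutant (carrier G) (left_reg G ` carrier G)", folded group_vN_def]
lemmas vN_adjoint_pair_id = adjoint_pair_id[OF commutant_subset_bounded[of "carrier G" "left_reg G ` carrier G"],
    folded group_vN_def]
lemmas vN_adjoint_pair_comb = adjoint_pair_comb[OF commutant_subset_bounded[of "carrier G" "left_reg G ` carrier G"],
    folded group_vN_def]
lemmas vN_adjoint_pair_sum = adjoint_pair_sum[OF commutant_subset_bounded[of "carrier G" "left_reg G ` carrier G"],
    folded group_vN_def]
lemmas vN_adjoint_pair_inverse = adjoint_pair_inverse[where A = "carrier G" and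
    X = "commutant (carrier G) (left_reg G ` carrier G)", folded group_vN_def]
lemmas vN_inverse = inverse_commutant[OF commutant_subset_bounded[of "carrier G" "left_reg G ` carrier G"],
    folded group_vN_def]
lemmas vN_unitary_pair_mult = unitary_pair_mult[OF commutant_subset_bounded[of "carrier G" "left_reg G ` carrier G"],
    folded group_vN_def]
lemmas vN_unitary_pair_phase = unitary_pair_phase[OF commutant_subset_bounded[of "carrier G" "left_reg G ` carrier G"],
    folded group_vN_def]
lemmas vN_unitary_pair_normal = unitary_pair_normal[OF commutant_subset_bounded[of "carrier G" "left_reg G ` carrier G"],
    folded group_vN_def]

lemma group_vN_bounded: "group_vN G \<subseteq> bounded_ops (carrier G)"
  unfolding group_vN_def by (rule commutant_subset_bounded)

lemma left_reg_adjoint_pair: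
  assumes "g \<in> carrier G"
  shows "adjoint_pair (carrier G) (group_vN G) (left_reg G g) (left_reg G (inv g))"
proof -
  have "left_reg G h \<in> group_vN G" if "h \<in> carrier G" for h
    using that left_reg_bounded[OF that] by (auto simp: group_vN_def mem_commutant_iff)
  then show ?thesis using assms by (auto simp: adjoint_pair_def left_reg_inner)
qed

lemma left_reg_unitary_pair:
  assumes "g \<in> carrier G"
  shows "unitary_pair (carrier G) (group_vN G) (left_reg G g) (left_reg G (inv g))"
  using assms left_reg_adjoint_pair[OF assms]
  by (auto simp: unitary_pair_def left_reg_mult left_reg_one)

lemma vN_trace_eq: "vN_trace G x = x (delta \<one>) \<one>"
  by (simp add: vN_trace_def ell2_inner_delta_right)

text \<open>The adjoint of \<open>\<lambda>\<^sub>g\<close> is translation by \<open>g\<^sup>-\<^sup>1\<close>, which moves the coordinate of \<open>x \<delta>\<^sub>e\<close> at \<open>g\<close>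
  to \<open>e\<close>, where the trace reads it off.\<close>

lemma fourier_coeff_eq:
  assumes "x \<in> group_vN G" "g \<in> carrier G"
  shows "fourier_coeff G x g = x (delta \<one>) g"
proof -
  have d: "delta \<one> \<in> ell2 (carrier G)" by (simp add: delta_in_ell2)
  have "x (delta \<one>) \<in> ell2 (carrier G)"
    using assms(1) d group_vN_bounded bounded_ops_closed by blast
  then show ?thesis
    using assms(2) op_adjoint_eq[OF left_reg_adjoint_pair[OF assms(2)] group_vN_bounded]
    by (simp add: fourier_coeff_def vN_trace_eq op_mult_apply d left_reg_apply)
qed

text \<open>Multiplication by \<open>\<lambda>\<^sub>c\<^sup>*\<close> translates the Fourier coefficients, so the requirement
  \<open>\<tau>(u) = 0\<close> may be replaced by the vanishing of any one coefficient.\<close>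

lemma unitary_of_vanishing_coefficient:
  assumes v: "unitary_pair (carrier G) (group_vN G) v w"
    and c: "c \<in> carrier G" "v (delta \<one>) c = 0"
    and g: "g \<in> carrier G" "v (delta \<one>) g \<noteq> 0" and h: "h \<in> carrier G" "v (delta \<one>) h \<noteq> 0"
    and "g \<noteq> h"
  shows "\<exists>u \<in> group_vN G. unitary_op (carrier G) u \<and> vN_trace G u = 0 \<and>
    (\<exists>g \<in> carrier G. \<exists>h \<in> carrier G. g \<noteq> h \<and>
      fourier_coeff G u g \<noteq> 0 \<and> fourier_coeff G u h \<noteq> 0)"
proof -
  let ?u = "op_mult (carrier G) (left_reg G (inv c)) v"
  have up: "unitary_pair (carrier G) (group_vN G) ?u (op_mult (carrier G) w (left_reg G (inv (inv c))))"
    by (rule vN_unitary_pair_mult[OF left_reg_unitary_pair v]) (simp add: c)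
  then have uM: "?u \<in> group_vN G" and uu: "unitary_op (carrier G) ?u"
    using unitary_pair_imp_unitary[OF up group_vN_bounded]
    by (auto simp: unitary_pair_def adjoint_pair_def)
  have d: "delta \<one> \<in> ell2 (carrier G)" by (simp add: delta_in_ell2)
  have "v (delta \<one>) \<in> ell2 (carrier G)"
    using v d vN_adjoint_pair_bounded(1)[of v w] bounded_ops_closed
    by (auto simp: unitary_pair_def)
  then have u\<delta>: "?u (delta \<one>) x = v (delta \<one>) (c \<otimes> x)" if "x \<in> carrier G" for x
    using that c(1) by (simp add: op_mult_apply d left_reg_apply)
  have "fourier_coeff G ?u (inv c \<otimes> x) = v (delta \<one>) x" if "x \<in> carrier G" for x
    using that c(1) by (simp add: fourier_coeff_eq[OF uM] u\<delta> m_assoc[symmetric])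
  moreover have "vN_trace G ?u = 0" using c by (simp add: vN_trace_eq u\<delta>)
  moreover have "inv c \<otimes> g \<noteq> inv c \<otimes> h" using c(1) g(1) h(1) \<open>g \<noteq> h\<close> by simp
  ultimately show ?thesis
    using uM uu c(1) g h by (intro bexI[of _ ?u] conjI bexI[of _ "inv c \<otimes> g"] bexI[of _ "inv c \<otimes> h"]) auto
qed


section \<open>Elements of finite order\<close>

text \<open>If \<open>\<omega>\<^sup>n = 1\<close> and \<open>a\<^sup>n = e\<close>, this is the spectral projection of \<open>\<lambda>\<^sub>a\<close> for the eigenvalue
  \<open>\<omega>\<^sup>-\<^sup>1\<close>.\<close>

definition cyclic_proj :: "'a \<Rightarrow> nat \<Rightarrow> complex \<Rightarrow> 'a ell2_op" where
  "cyclic_proj a n \<omega> =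
     (\<lambda>f\<in>ell2 (carrier G). (\<lambda>x. \<Sum>k<n. (\<omega> ^ k / of_nat n) * left_reg G (a [^] k) f x))"

lemma left_reg_pow_Suc:
  assumes "a \<in> carrier G" "f \<in> ell2 (carrier G)" "x \<in> carrier G"
  shows "left_reg G (a [^] (k::nat)) f (inv a \<otimes> x) = left_reg G (a [^] Suc k) f x"
  using fun_cong[OF left_reg_apply[OF left_reg_ell2(1)[of "a [^] k" f], of a], of x]
    left_reg_mult[of a "a [^] k" f] assms nat_pow_Suc2[of a k] by simp

lemma sum_cyclic_shift:
  fixes F :: "nat \<Rightarrow> complex"
  assumes "F n = F 0"
  shows "(\<Sum>k<n. F (Suc k)) = (\<Sum>k<n. F k)"
  using sum.lessThan_Suc_shift[of F n] sum.lessThan_Suc[of F n] assms by simp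

lemma sum_cyclic_reverse:
  fixes F :: "nat \<Rightarrow> complex"
  assumes "F n = F 0"
  shows "(\<Sum>k<n. F (n - k)) = (\<Sum>k<n. F k)"
proof -
  have "(\<Sum>k<n. F (n - k)) = (\<Sum>k<n. F (Suc (n - Suc k)))"
    by (intro sum.cong) (auto simp: Suc_diff_Suc)
  also have "\<dots> = (\<Sum>k<n. F (Suc k))" by (rule sum.nat_diff_reindex)
  finally show ?thesis by (simp add: sum_cyclic_shift[of F, OF assms])
qed

context
  fixes a :: 'a and n :: nat
  assumes a: "a \<in> carrier G" and an: "a [^] n = \<one>"
begin

text \<open>Since \<open>\<omega>\<^sup>-\<^sup>k = \<omega>\<^sup>n\<^sup>-\<^sup>k\<close> and \<open>a\<^sup>-\<^sup>k = a\<^sup>n\<^sup>-\<^sup>k\<close>, taking adjoints only reverses the order of the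
  summands.\<close>

lemma cyclic_proj_adjoint_pair:
  assumes \<omega>: "cmod \<omega> = 1" "\<omega> ^ n = 1"
  shows "adjoint_pair (carrier G) (group_vN G) (cyclic_proj a n \<omega>) (cyclic_proj a n \<omega>)"
proof -
  have ap: "adjoint_pair (carrier G) (group_vN G) (cyclic_proj a n \<omega>)
    (\<lambda>f\<in>ell2 (carrier G). (\<lambda>x. \<Sum>k<n. cnj (\<omega> ^ k / of_nat n) * left_reg G (inv (a [^] k)) f x))"
    unfolding cyclic_proj_def
    by (intro vN_adjoint_pair_sum left_reg_adjoint_pair nat_pow_closed a)
  have "cnj (\<omega> ^ k / of_nat n) * left_reg G (inv (a [^] k)) f x
      = (\<omega> ^ (n - k) / of_nat n) * left_reg G (a [^] (n - k)) f x" if k: "k < n" for k f x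
  proof -
    have "\<omega> ^ k * \<omega> ^ (n - k) = 1" using k \<omega>(2) by (simp flip: power_add)
    moreover have "\<omega> * cnj \<omega> = 1" using \<omega>(1) by (simp add: complex_norm_square[symmetric])
    then have "\<omega> ^ k * cnj (\<omega> ^ k) = 1" by (metis complex_cnj_power power_mult_distrib power_one)
    ultimately have "cnj (\<omega> ^ k) = \<omega> ^ (n - k)"
      by (metis mult_cancel_left mult_zero_left zero_neq_one)
    moreover have "a [^] (n - k) \<otimes> a [^] k = \<one>" using k a an by (simp add: nat_pow_mult)
    then have "inv (a [^] k) = a [^] (n - k)" using a by (simp add: inv_equality)
    ultimately show ?thesis by simp
  qed
  then have "(\<Sum>k<n. cnj (\<omega> ^ k / of_nat n) * left_reg G (inv (a [^] k)) f x)
      = (\<Sum>k<n. (\<omega> ^ k / of_nat n) * left_reg G (a [^] k) f x)" for f x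
    using sum_cyclic_reverse[of "\<lambda>k. (\<omega> ^ k / of_nat n) * left_reg G (a [^] k) f x" n] a an \<omega>
    by simp
  with ap show ?thesis by (simp add: cyclic_proj_def)
qed

lemma cyclic_proj_closed:
  assumes "cmod \<omega> = 1" "\<omega> ^ n = 1" "f \<in> ell2 (carrier G)"
  shows "cyclic_proj a n \<omega> f \<in> ell2 (carrier G)"
  using vN_adjoint_pair_bounded(1)[OF cyclic_proj_adjoint_pair[OF assms(1,2)]] assms(3)
  by (rule bounded_ops_closed)

text \<open>Translation by \<open>a\<close> shifts the sum cyclically, so the range of the projection consists of
  eigenvectors of \<open>\<lambda>\<^sub>a\<close>; products of two such projections then reduce to geometric sums.\<close>

lemma left_reg_cyclic_proj:
  assumes \<omega>: "cmod \<omega> = 1" "\<omega> ^ n = 1" and f: "f \<in> ell2 (carrier G)"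
  shows "left_reg G (a [^] k) (cyclic_proj a n \<omega> f) = (\<lambda>x. cnj \<omega> ^ k * cyclic_proj a n \<omega> f x)"
proof (induction k)
  case 0
  show ?case by (simp add: left_reg_one cyclic_proj_closed \<omega> f)
next
  case (Suc k)
  note c = cyclic_proj_closed[OF \<omega> f]
  have 1: "\<omega> * cnj \<omega> = 1" using \<omega>(1) by (simp add: complex_norm_square[symmetric])
  have step: "left_reg G a (cyclic_proj a n \<omega> f) = (\<lambda>x. cnj \<omega> * cyclic_proj a n \<omega> f x)"
  proof
    fix x
    show "left_reg G a (cyclic_proj a n \<omega> f) x = cnj \<omega> * cyclic_proj a n \<omega> f x"
    proof (cases "x \<in> carrier G")
      case True
      have "left_reg G a (cyclic_proj a n \<omega> f) x
          = (\<Sum>k<n. (\<omega> ^ k / of_nat n) * left_reg G (a [^] Suc k) f x)"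
        using True left_reg_pow_Suc[OF a f True]
        by (simp only: left_reg_apply[OF c]) (simp add: cyclic_proj_def f)
      also have "\<dots> = (\<Sum>k<n. cnj \<omega> * ((\<omega> ^ Suc k / of_nat n) * left_reg G (a [^] Suc k) f x))"
        using 1 by (intro sum.cong) (auto simp: mult.assoc[symmetric] mult.commute[of "cnj \<omega>"])
      also have "\<dots> = cnj \<omega> * (\<Sum>k<n. (\<omega> ^ k / of_nat n) * left_reg G (a [^] k) f x)"
        using sum_cyclic_shift[of "\<lambda>k. (\<omega> ^ k / of_nat n) * left_reg G (a [^] k) f x" n] an \<omega>(2)
        by (simp only: sum_distrib_left[symmetric]) simp
      finally show ?thesis by (simp add: cyclic_proj_def f)
    next
      case False
      then show ?thesis by (simp add: ell2_vanishes[OF c] ell2_vanishes[OF left_reg_ell2(1)[OF a c]])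
    qed
  qed
  have "left_reg G (a [^] Suc k) (cyclic_proj a n \<omega> f)
      = left_reg G a (left_reg G (a [^] k) (cyclic_proj a n \<omega> f))"
    using a nat_pow_Suc2[of a k] by (simp add: left_reg_mult c)
  also have "\<dots> = (\<lambda>x. cnj \<omega> ^ k * left_reg G a (cyclic_proj a n \<omega> f) x)"
    using bounded_ops_lincomb[OF left_reg_bounded[OF a] c c, of "cnj \<omega> ^ k" 0] Suc.IH by simp
  finally show ?case by (simp add: step mult_ac)
qed

lemma cyclic_proj_mult:
  assumes \<omega>: "cmod \<omega> = 1" "\<omega> ^ n = 1" and f: "f \<in> ell2 (carrier G)"
  shows "cyclic_proj a n \<theta> (cyclic_proj a n \<omega> f)
    = (\<lambda>x. (\<Sum>k<n. (\<theta> * cnj \<omega>) ^ k) / of_nat n * cyclic_proj a n \<omega> f x)"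
proof -
  have "cyclic_proj a n \<theta> (cyclic_proj a n \<omega> f)
    = (\<lambda>x. \<Sum>k<n. (\<theta> ^ k / of_nat n) * (cnj \<omega> ^ k * cyclic_proj a n \<omega> f x))"
    by (subst cyclic_proj_def) (simp add: cyclic_proj_closed left_reg_cyclic_proj \<omega> f)
  then show ?thesis
    by (simp add: sum_distrib_left sum_distrib_right sum_divide_distrib power_mult_distrib mult_ac)
qed

lemma cyclic_proj_idem:
  assumes \<omega>: "cmod \<omega> = 1" "\<omega> ^ n = 1" and f: "f \<in> ell2 (carrier G)" and n: "0 < n"
  shows "cyclic_proj a n \<omega> (cyclic_proj a n \<omega> f) = cyclic_proj a n \<omega> f"
proof -
  have "\<omega> * cnj \<omega> = 1" using \<omega>(1) by (simp add: complex_norm_square[symmetric])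
  then show ?thesis using n by (simp add: cyclic_proj_mult[OF \<omega> f])
qed

lemma cyclic_proj_orthogonal:
  assumes \<omega>: "cmod \<omega> = 1" "\<omega> ^ n = 1" and f: "f \<in> ell2 (carrier G)" and "\<omega> \<noteq> 1"
  shows "cyclic_proj a n 1 (cyclic_proj a n \<omega> f) = (\<lambda>x. 0)"
proof -
  have "cnj \<omega> \<noteq> 1" using \<open>\<omega> \<noteq> 1\<close> by (metis complex_cnj_cnj complex_cnj_one)
  moreover have "cnj \<omega> ^ n = 1" using \<omega>(2) by (metis complex_cnj_one complex_cnj_power)
  ultimately have "(\<Sum>k<n. cnj \<omega> ^ k) = 0" by (simp add: geometric_sum)
  then show ?thesis by (simp add: cyclic_proj_mult[OF \<omega> f])
qed

lemma cyclic_proj_delta: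
  "cyclic_proj a n \<omega> (delta \<one>) x = (\<Sum>k<n. if x = a [^] k then \<omega> ^ k / of_nat n else 0)"
  using a by (simp add: cyclic_proj_def delta_in_ell2 left_reg_delta)
    (auto simp: delta_def intro!: sum.cong)

end

lemma cyclic_proj_delta_pow:
  assumes a: "a \<in> carrier G" and m: "m < ord a"
  shows "cyclic_proj a (ord a) \<omega> (delta \<one>) (a [^] m) = \<omega> ^ m / of_nat (ord a)"
proof -
  have "a [^] m = a [^] k \<longleftrightarrow> k = m" if "k < ord a" for k
    using inj_onD[OF ord_inj[OF a], of m k] m that by fastforce
  then have "cyclic_proj a (ord a) \<omega> (delta \<one>) (a [^] m)
      = (\<Sum>k<ord a. if k = m then \<omega> ^ k / of_nat (ord a) else 0)"
    by (simp only: cyclic_proj_delta[OF a pow_ord_eq_1[OF a]]) (auto intro!: sum.cong)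
  then show ?thesis using m by simp
qed

text \<open>Let \<open>n\<close> be the order of \<open>a\<close>. With \<open>\<omega> = exp (2\<pi>\<i>/n)\<close> and \<open>p\<^sub>0, p\<^sub>1\<close> the projections for the eigenvalues \<open>1\<close> and \<open>\<omega>\<^sup>-\<^sup>1\<close> of
  \<open>\<lambda>\<^sub>a\<close>, the unitary \<open>\<omega> p\<^sub>0 + \<omega>\<^sup>-\<^sup>1 p\<^sub>1 + (1 - p\<^sub>0 - p\<^sub>1)\<close> has, at \<open>a\<^sup>m\<close> with \<open>0 < m < n\<close>, the coefficient
  \<open>(\<omega> - 1)(1 - \<omega>\<^sup>m\<^sup>-\<^sup>1)/n\<close>. It vanishes at \<open>a\<close> but neither at \<open>a\<^sup>2\<close> nor at \<open>a\<^sup>3\<close>.\<close>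

lemma vanishing_coefficient_order_ge_4:
  assumes a: "a \<in> carrier G" and n: "4 \<le> ord a"
  obtains v w where "unitary_pair (carrier G) (group_vN G) v w" "v (delta \<one>) a = 0"
    "v (delta \<one>) (a [^] (2::nat)) \<noteq> 0" "v (delta \<one>) (a [^] (3::nat)) \<noteq> 0"
    "a [^] (2::nat) \<noteq> a [^] (3::nat)"
proof -
  define n where "n = ord a"
  define \<omega> where "\<omega> = cis (2 * pi / real n)"
  have n4: "4 \<le> n" using n by (simp add: n_def)
  have an: "a [^] n = \<one>" using a by (simp add: n_def)
  have \<omega>: "cmod \<omega> = 1" "\<omega> ^ n = 1"
    using n4 by (auto simp: \<omega>_def DeMoivre)
  have \<omega>k: "\<omega> ^ k \<noteq> 1" if "0 < k" "k < n" for k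
  proof
    assume "\<omega> ^ k = 1"
    then have "cis (2 * pi * real k / real n) = cis (2 * pi * real 0 / real n)"
      by (simp add: \<omega>_def DeMoivre mult_ac)
    moreover have inj: "inj_on (\<lambda>k. cis (2 * pi * real k / real n)) {..<n}"
      using bij_betw_roots_unity[of n] n4 by (simp add: bij_betw_def)
    ultimately show False using inj_onD[OF inj, of k 0] that by auto
  qed
  have \<omega>1: "\<omega> \<noteq> 1" and \<omega>2: "\<omega> ^ 2 \<noteq> 1" using \<omega>k[of 1] \<omega>k[of 2] n4 by auto
  have \<omega>c: "cnj \<omega> * \<omega> = 1" using \<omega>(1) by (simp add: complex_norm_square[symmetric] mult.commute)
  let ?p = "cyclic_proj a n 1" and ?q = "cyclic_proj a n \<omega>"
  let ?P = "\<lambda>\<alpha>. op_comb (carrier G) 1 (op_id (carrier G)) (\<alpha> - 1) ?p"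
  let ?Q = "\<lambda>\<alpha>. op_comb (carrier G) 1 (op_id (carrier G)) (\<alpha> - 1) ?q"
  let ?v = "op_mult (carrier G) (?P \<omega>) (?Q (cnj \<omega>))"
  let ?w = "op_mult (carrier G) (?Q (cnj (cnj \<omega>))) (?P (cnj \<omega>))"
  have P: "unitary_pair (carrier G) (group_vN G) (?P \<omega>) (?P (cnj \<omega>))"
    using n4 \<omega> by (intro vN_unitary_pair_phase cyclic_proj_adjoint_pair cyclic_proj_idem a an) auto
  have Q: "unitary_pair (carrier G) (group_vN G) (?Q (cnj \<omega>)) (?Q (cnj (cnj \<omega>)))"
    using n4 \<omega> by (intro vN_unitary_pair_phase cyclic_proj_adjoint_pair cyclic_proj_idem a an) auto
  have v: "unitary_pair (carrier G) (group_vN G) ?v ?w"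
    by (rule vN_unitary_pair_mult[OF P Q])
  have d: "delta \<one> \<in> ell2 (carrier G)" by (simp add: delta_in_ell2)
  have qd: "?q (delta \<one>) \<in> ell2 (carrier G)" by (rule cyclic_proj_closed[OF a an \<omega> d])
  have pb: "?p \<in> bounded_ops (carrier G)"
    by (rule vN_adjoint_pair_bounded(1)[OF cyclic_proj_adjoint_pair[OF a an]]) auto
  \<comment> \<open>As \<open>?p\<close> annihilates the range of \<open>?q\<close>, the two phase changes simply add up.\<close>
  have "?p (\<lambda>x. delta \<one> x + (cnj \<omega> - 1) * ?q (delta \<one>) x) = ?p (delta \<one>)"
    using bounded_ops_lincomb[OF pb d qd, of 1 "cnj \<omega> - 1"]
    by (simp add: cyclic_proj_orthogonal[OF a an \<omega> d \<omega>1])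
  then have vd: "?v (delta \<one>) x
      = delta \<one> x + (cnj \<omega> - 1) * ?q (delta \<one>) x + (\<omega> - 1) * ?p (delta \<one>) x" for x
    using ell2_lincomb(1)[OF d qd, of 1 "cnj \<omega> - 1"]
    by (simp add: op_mult_apply op_comb_apply op_id_def d)
  have am: "a [^] m \<noteq> \<one>" if "0 < m" "m < n" for m
    using that a by (auto simp: pow_eq_id n_def dest: dvd_imp_le)
  have coeff: "?v (delta \<one>) (a [^] Suc m) = (\<omega> - 1) * (1 - \<omega> ^ m) / of_nat n" if "Suc m < n" for m
  proof -
    have "?v (delta \<one>) (a [^] Suc m)
      = ((cnj \<omega> - 1) * \<omega> ^ Suc m + (\<omega> - 1)) / of_nat n"
      using cyclic_proj_delta_pow[OF a, of "Suc m"] that am[of "Suc m"]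
      by (simp only: vd) (simp add: n_def delta_def add_divide_distrib)
    also have "(cnj \<omega> - 1) * \<omega> ^ Suc m + (\<omega> - 1) = (\<omega> - 1) * (1 - \<omega> ^ m)"
      using \<omega>c by (simp add: algebra_simps) 
    finally show ?thesis .
  qed
  show thesis
  proof (rule that[OF v])
    show "?v (delta \<one>) a = 0" using coeff[of 0] n4 a by simp
    show "?v (delta \<one>) (a [^] (2::nat)) \<noteq> 0"
      using coeff[of 1] n4 \<omega>1 by (simp add: numeral_2_eq_2)
    show "?v (delta \<one>) (a [^] (3::nat)) \<noteq> 0"
      using coeff[of 2] n4 \<omega>1 \<omega>2 by (simp add: numeral_3_eq_3)
    show "a [^] (2::nat) \<noteq> a [^] (3::nat)"
      using inj_onD[OF ord_inj[OF a], of 2 3] n by fastforce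
  qed
qed

text \<open>With \<open>p\<close> the projection onto the vectors fixed by \<open>\<lambda>\<^sub>a\<close>, the unitary \<open>1 + (\<i> - 1) p\<close> has
  coefficient \<open>1 + (\<i> - 1)/n\<close> at \<open>e\<close>, and \<open>(\<i> - 1)/n\<close> at the other powers of \<open>a\<close>. The phase is taken to
  be \<open>\<i>\<close> because the phase \<open>-1\<close> would give the coefficient \<open>0\<close> at \<open>e\<close> for \<open>n = 2\<close>.\<close>

lemma vanishing_coefficient_outside_cyclic:
  assumes a: "a \<in> carrier G" and n: "2 \<le> ord a"
    and c: "\<And>k. k < ord a \<Longrightarrow> c \<noteq> a [^] k"
  obtains v w where "unitary_pair (carrier G) (group_vN G) v w" "v (delta \<one>) c = 0"
    "v (delta \<one>) \<one> \<noteq> 0" "v (delta \<one>) a \<noteq> 0"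
proof -
  define n where "n = ord a"
  have n2: "2 \<le> n" using n by (simp add: n_def)
  have an: "a [^] n = \<one>" using a by (simp add: n_def)
  let ?p = "cyclic_proj a n 1"
  let ?P = "\<lambda>\<alpha>. op_comb (carrier G) 1 (op_id (carrier G)) (\<alpha> - 1) ?p"
  have v: "unitary_pair (carrier G) (group_vN G) (?P \<i>) (?P (cnj \<i>))"
    using n2 by (intro vN_unitary_pair_phase cyclic_proj_adjoint_pair cyclic_proj_idem a an) auto
  have vd: "?P \<i> (delta \<one>) x = delta \<one> x + (\<i> - 1) * ?p (delta \<one>) x" for x
    by (simp add: op_comb_apply op_id_def delta_in_ell2)
  have p: "?p (delta \<one>) (a [^] m) = 1 / of_nat n" if "m < n" for m
    using cyclic_proj_delta_pow[OF a, of m] that by (simp add: n_def)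
  show thesis
  proof (rule that[OF v])
    have "?p (delta \<one>) c = 0"
      using c by (subst cyclic_proj_delta[OF a an]) (auto simp: n_def)
    moreover have "c \<noteq> \<one>" using c[of 0] n by auto
    ultimately show "?P \<i> (delta \<one>) c = 0" by (simp add: vd) (simp add: delta_def)
    have "?P \<i> (delta \<one>) \<one> = 1 + (\<i> - 1) / of_nat n"
      using p[of 0] n2 by (simp add: vd) (simp add: delta_def)
    moreover have "Im (1 + (\<i> - 1) / of_nat n) \<noteq> 0" using n2 by simp
    ultimately show "?P \<i> (delta \<one>) \<one> \<noteq> 0" by force
    have "a \<noteq> \<one>" using n by auto
    then show "?P \<i> (delta \<one>) a \<noteq> 0"
      using p[of 1] n2 a by (simp add: vd) (simp add: delta_def complex_eq_iff)
  qed
qed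


section \<open>Elements of infinite order\<close>

text \<open>The Neumann series \<open>\<Sum>\<^sub>k r\<^sup>k \<lambda>\<^sub>b\<^sup>k\<close>, which is the inverse of \<open>1 - r \<lambda>\<^sub>b\<close> for \<open>0 \<le> r < 1\<close>. It
  converges absolutely at each point, so it is summed pointwise.\<close>

definition neumann :: "real \<Rightarrow> 'a \<Rightarrow> 'a ell2_op" where
  "neumann r b = (\<lambda>f\<in>ell2 (carrier G). (\<lambda>x. \<Sum>k. of_real (r ^ k) * left_reg G (b [^] k) f x))"

definition one_minus :: "real \<Rightarrow> 'a \<Rightarrow> 'a ell2_op" where
  "one_minus r b = op_comb (carrier G) 1 (op_id (carrier G)) (- of_real r) (left_reg G b)"

lemma one_minus_apply:
  "f \<in> ell2 (carrier G) \<Longrightarrow> one_minus r b f = (\<lambda>x. f x - of_real r * left_reg G b f x)"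
  by (simp add: one_minus_def op_comb_apply op_id_def)

lemma one_minus_adjoint_pair:
  assumes "b \<in> carrier G"
  shows "adjoint_pair (carrier G) (group_vN G) (one_minus r b) (one_minus r (inv b))"
  using vN_adjoint_pair_comb[OF vN_adjoint_pair_id left_reg_adjoint_pair[OF assms], of 1 "- of_real r"]
  by (simp add: one_minus_def)

context
  fixes r :: real and b :: 'a
  assumes r: "0 \<le> r" "r < 1" and b: "b \<in> carrier G"
begin

lemma neumann_summable:
  assumes f: "f \<in> ell2 (carrier G)"
  shows "summable (\<lambda>k. complex_of_real (r ^ k) * left_reg G (b [^] k) f x)"
proof (rule summable_comparison_test')
  show "summable (\<lambda>k. r ^ k * sqrt (sq_norm (carrier G) f))"
    using r by (intro summable_mult2 summable_geometric) auto
  fix k :: nat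
  have g: "b [^] k \<in> carrier G" using b by simp
  note c = left_reg_ell2[OF g f]
  have "cmod (left_reg G (b [^] k) f x) \<le> sqrt (sq_norm (carrier G) f)"
  proof (cases "x \<in> carrier G")
    case True
    show ?thesis using cmod_sq_le_sq_norm[OF c(1) True] c(2) by (intro real_le_rsqrt) simp
  qed (simp add: ell2_vanishes[OF c(1)] sq_norm_nonneg)
  then show "cmod (complex_of_real (r ^ k) * left_reg G (b [^] k) f x)
      \<le> r ^ k * sqrt (sq_norm (carrier G) f)"
    using r by (simp add: norm_mult norm_power mult_left_mono)
qed

text \<open>By the Cauchy-Schwarz inequality with weights \<open>r\<^sup>k\<close>, whose total mass is at most
  \<open>1 / (1 - r)\<close>, and since the \<open>\<lambda>\<^sub>b\<^sup>k\<close> are isometric.\<close>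

lemma neumann_finite_bound:
  assumes f: "f \<in> ell2 (carrier G)" and F: "finite F" "F \<subseteq> carrier G"
  shows "(\<Sum>x\<in>F. (cmod (neumann r b f x))\<^sup>2) \<le> (1 / (1 - r))\<^sup>2 * sq_norm (carrier G) f"
proof -
  define t where "t k x = cmod (left_reg G (b [^] k) f x)" for k :: nat and x
  define s where "s N x = (\<Sum>k<N. complex_of_real (r ^ k) * left_reg G (b [^] k) f x)" for N :: nat and x
  have mass: "(\<Sum>k<N. r ^ k) \<le> 1 / (1 - r)" for N
    using r sum_le_suminf[OF summable_geometric[of r], of "{..<N}"] suminf_geometric[of r] by simp
  have t: "(\<Sum>x\<in>F. (t k x)\<^sup>2) \<le> sq_norm (carrier G) f" for k
    using finite_sum_le_infsum[OF ell2_summable[OF left_reg_ell2(1)[of "b [^] k" f]] F]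
      left_reg_ell2(2)[of "b [^] k" f] f b by (simp add: t_def)
  have point: "(cmod (s N x))\<^sup>2 \<le> 1 / (1 - r) * (\<Sum>k<N. r ^ k * (t k x)\<^sup>2)" for N x
  proof -
    have "cmod (s N x) \<le> (\<Sum>k<N. sqrt (r ^ k) * (sqrt (r ^ k) * t k x))"
      unfolding s_def t_def using r
      by (intro order_trans[OF norm_sum] sum_mono) (simp add: norm_mult norm_power mult.assoc[symmetric])
    then have "(cmod (s N x))\<^sup>2 \<le> (\<Sum>k<N. sqrt (r ^ k) * (sqrt (r ^ k) * t k x))\<^sup>2"
      by (intro power_mono) auto
    also have "\<dots> \<le> (\<Sum>k<N. (sqrt (r ^ k))\<^sup>2) * (\<Sum>k<N. (sqrt (r ^ k) * t k x)\<^sup>2)"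
      by (rule Cauchy_Schwarz_ineq_sum)
    also have "\<dots> = (\<Sum>k<N. r ^ k) * (\<Sum>k<N. r ^ k * (t k x)\<^sup>2)"
      using r by (simp add: power_mult_distrib)
    also have "\<dots> \<le> 1 / (1 - r) * (\<Sum>k<N. r ^ k * (t k x)\<^sup>2)"
      using r by (intro mult_right_mono mass sum_nonneg) auto
    finally show ?thesis .
  qed
  have bound: "(\<Sum>x\<in>F. (cmod (s N x))\<^sup>2) \<le> (1 / (1 - r))\<^sup>2 * sq_norm (carrier G) f" for N
  proof -
    have "(\<Sum>x\<in>F. (cmod (s N x))\<^sup>2) \<le> (\<Sum>x\<in>F. 1 / (1 - r) * (\<Sum>k<N. r ^ k * (t k x)\<^sup>2))"
      by (intro sum_mono point)
    also have "\<dots> = 1 / (1 - r) * (\<Sum>x\<in>F. \<Sum>k<N. r ^ k * (t k x)\<^sup>2)"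
      by (simp only: sum_distrib_left)
    also have "\<dots> = 1 / (1 - r) * (\<Sum>k<N. r ^ k * (\<Sum>x\<in>F. (t k x)\<^sup>2))"
      by (subst sum.swap) (simp only: sum_distrib_left)
    also have "\<dots> \<le> 1 / (1 - r) * (\<Sum>k<N. r ^ k * sq_norm (carrier G) f)"
      using r by (intro mult_left_mono sum_mono t) auto
    also have "\<dots> = 1 / (1 - r) * ((\<Sum>k<N. r ^ k) * sq_norm (carrier G) f)"
      by (simp only: sum_distrib_right)
    also have "\<dots> \<le> 1 / (1 - r) * (1 / (1 - r) * sq_norm (carrier G) f)"
      using r by (intro mult_left_mono mult_right_mono mass sq_norm_nonneg) auto
    finally show ?thesis by (simp only: power2_eq_square mult.assoc)
  qed
  have "(\<lambda>N. s N x) \<longlonglongrightarrow> neumann r b f x" for x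
    unfolding s_def using summable_LIMSEQ[OF neumann_summable[OF f]] by (simp add: neumann_def f)
  then have "(\<lambda>N. \<Sum>x\<in>F. (cmod (s N x))\<^sup>2) \<longlonglongrightarrow> (\<Sum>x\<in>F. (cmod (neumann r b f x))\<^sup>2)"
    by (intro tendsto_intros)
  then show ?thesis by (rule LIMSEQ_le_const2) (use bound in blast)
qed

lemma neumann_ell2:
  assumes f: "f \<in> ell2 (carrier G)"
  shows "neumann r b f \<in> ell2 (carrier G)"
    and "sq_norm (carrier G) (neumann r b f) \<le> (1 / (1 - r))\<^sup>2 * sq_norm (carrier G) f"
proof -
  have s: "(\<lambda>x. (cmod (neumann r b f x))\<^sup>2) summable_on carrier G"
    using neumann_finite_bound[OF f]
    by (intro nonneg_bdd_above_summable_on bdd_aboveI2) auto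
  moreover have "neumann r b f x = 0" if "x \<notin> carrier G" for x
    using that by (simp add: neumann_def f left_reg_apply)
  ultimately show "neumann r b f \<in> ell2 (carrier G)" by (subst ell2_def) simp
  show "sq_norm (carrier G) (neumann r b f) \<le> (1 / (1 - r))\<^sup>2 * sq_norm (carrier G) f"
    by (rule infsum_le_finite_sums[OF s neumann_finite_bound[OF f]])
qed

lemma one_minus_neumann:
  assumes f: "f \<in> ell2 (carrier G)"
  shows "one_minus r b (neumann r b f) = f"
proof
  fix x
  note c = neumann_ell2(1)[OF f]
  show "one_minus r b (neumann r b f) x = f x"
  proof (cases "x \<in> carrier G")
    case True
    let ?u = "\<lambda>k. complex_of_real (r ^ k) * left_reg G (b [^] k) f x"
    have su: "summable (\<lambda>k. of_real (r ^ k) * left_reg G (b [^] Suc k) f x)"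
      using neumann_summable[OF f, of "inv b \<otimes> x"] left_reg_pow_Suc[OF b f True] by simp
    have "neumann r b f x = ?u 0 + (\<Sum>k. ?u (Suc k))"
      using suminf_split_head[OF neumann_summable[OF f], of x] by (simp add: neumann_def f)
    also have "(\<Sum>k. ?u (Suc k)) = of_real r * (\<Sum>k. of_real (r ^ k) * left_reg G (b [^] Suc k) f x)"
      using suminf_mult[OF su, of "of_real r"] by (simp add: mult.assoc)
    also have "(\<Sum>k. of_real (r ^ k) * left_reg G (b [^] Suc k) f x) = left_reg G b (neumann r b f) x"
      using True left_reg_pow_Suc[OF b f True]
      by (simp only: left_reg_apply[OF c]) (simp add: neumann_def f)
    finally show ?thesis by (simp add: one_minus_apply c left_reg_one f)
  next
    case False
    then show ?thesis
      using b by (simp add: one_minus_apply c ell2_vanishes[OF f] ell2_vanishes[OF c]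
        ell2_vanishes[OF left_reg_ell2(1)[OF b c]])
  qed
qed

lemma neumann_one_minus:
  assumes f: "f \<in> ell2 (carrier G)"
  shows "neumann r b (one_minus r b f) = f"
proof
  fix x
  let ?u = "\<lambda>k. complex_of_real (r ^ k) * left_reg G (b [^] k) f x"
  have lf: "left_reg G b f \<in> ell2 (carrier G)" by (rule left_reg_ell2(1)[OF b f])
  have h: "one_minus r b f \<in> ell2 (carrier G)"
    using ell2_lincomb(1)[OF f lf, of 1 "- of_real r"] by (simp add: one_minus_apply f)
  have "left_reg G (b [^] k) (one_minus r b f) x
      = left_reg G (b [^] k) f x - of_real r * left_reg G (b [^] Suc k) f x" for k :: nat
    using bounded_ops_lincomb[OF left_reg_bounded[of "b [^] k"] f lf, of 1 "- of_real r"] b f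
    by (simp add: one_minus_apply left_reg_mult)
  then have "neumann r b (one_minus r b f) x = (\<Sum>k. ?u k - ?u (Suc k))"
    by (simp add: neumann_def h right_diff_distrib mult_ac del: nat_pow_Suc)
  also have "\<dots> = (\<Sum>k. ?u k) - (\<Sum>k. ?u (Suc k))"
    using neumann_summable[OF f, of x] summable_Suc_iff[of ?u] by (intro suminf_diff[symmetric]) auto
  also have "\<dots> = f x"
    using suminf_split_head[OF neumann_summable[OF f], of x] by (simp add: left_reg_one f)
  finally show "neumann r b (one_minus r b f) x = f x" .
qed

text \<open>The series is not a finite combination of translations; it lies in \<open>L(G)\<close> as the inverse of
  an element of \<open>L(G)\<close>.\<close>

lemma neumann_in_vN: "neumann r b \<in> group_vN G"
proof (rule vN_inverse[OF _ _ one_minus_neumann neumann_one_minus neumann_ell2(2)])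
  show "one_minus r b \<in> group_vN G"
    using one_minus_adjoint_pair[OF b] by (simp add: adjoint_pair_def)
  show "neumann r b \<in> ell2 (carrier G) \<rightarrow>\<^sub>E ell2 (carrier G)"
    using neumann_ell2(1) by (auto simp: neumann_def)
qed

lemma neumann_delta: "neumann r b (delta \<one>) x = (\<Sum>k. if x = b [^] k then of_real (r ^ k) else 0)"
  using b by (simp add: neumann_def delta_in_ell2 left_reg_delta)
    (auto simp: delta_def intro!: arg_cong[where f = suminf])

end

text \<open>The unitary is \<open>(1 - r \<lambda>\<^sub>a\<^sup>*)(1 - r \<lambda>\<^sub>a)\<^sup>-\<^sup>1\<close>. The coefficients of the Neumann series are \<open>r\<^sup>k\<close> at
  \<open>a\<^sup>k\<close> for \<open>k \<ge> 0\<close> and \<open>0\<close> elsewhere, because the powers of \<open>a\<close> are distinct. Multiplication by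
  \<open>1 - r \<lambda>\<^sub>a\<^sup>*\<close> yields \<open>-r\<close> at \<open>a\<^sup>-\<^sup>1\<close>, \<open>1 - r\<^sup>2\<close> at \<open>e\<close>, and \<open>0\<close> at \<open>a\<^sup>-\<^sup>2\<close>.\<close>

lemma vanishing_coefficient_infinite_order:
  assumes a: "a \<in> carrier G" and ord: "ord a = 0"
  obtains v w where "unitary_pair (carrier G) (group_vN G) v w" "v (delta \<one>) (inv a \<otimes> inv a) = 0"
    "v (delta \<one>) (inv a) \<noteq> 0" "v (delta \<one>) \<one> \<noteq> 0" "inv a \<noteq> \<one>"
proof -
  define r :: real where "r = 1 / 2"
  have r: "0 \<le> r" "r < 1" by (simp_all add: r_def)
  have ia: "inv a \<in> carrier G" using a by simp
  let ?b = "one_minus r a" and ?b' = "one_minus r (inv a)"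
  let ?n = "neumann r a" and ?n' = "neumann r (inv a)"
  have d: "delta \<one> \<in> ell2 (carrier G)" by (simp add: delta_in_ell2)
  note bn = one_minus_neumann[OF r a] neumann_one_minus[OF r a]
    and bn' = one_minus_neumann[OF r ia] neumann_one_minus[OF r ia]
  have B: "adjoint_pair (carrier G) (group_vN G) ?b ?b'" by (rule one_minus_adjoint_pair[OF a])
  have N: "adjoint_pair (carrier G) (group_vN G) ?n ?n'"
    by (rule vN_adjoint_pair_inverse[OF B neumann_in_vN[OF r a] bn(1) neumann_in_vN[OF r ia] bn'(1)])
  have normal: "?b (?b' f) = ?b' (?b f)" if f: "f \<in> ell2 (carrier G)" for f
  proof -
    note lb = left_reg_bounded[OF a] left_reg_bounded[OF ia]
    note lc = left_reg_ell2(1)[OF a f] left_reg_ell2(1)[OF ia f]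
    have "?b f \<in> ell2 (carrier G)" "?b' f \<in> ell2 (carrier G)"
      using vN_adjoint_pair_bounded[OF B, THEN bounded_ops_closed[OF _ f]] .
    moreover have "left_reg G a (\<lambda>x. f x - of_real r * left_reg G (inv a) f x)
        = (\<lambda>x. left_reg G a f x - of_real r * f x)"
      using bounded_ops_lincomb[OF lb(1) f lc(2), of 1 "- of_real r"] a f
      by (simp add: left_reg_mult left_reg_one)
    moreover have "left_reg G (inv a) (\<lambda>x. f x - of_real r * left_reg G a f x)
        = (\<lambda>x. left_reg G (inv a) f x - of_real r * f x)"
      using bounded_ops_lincomb[OF lb(2) f lc(1), of 1 "- of_real r"] a f
      by (simp add: left_reg_mult left_reg_one)
    ultimately show ?thesis by (simp add: one_minus_apply f algebra_simps)
  qed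
  let ?v = "op_mult (carrier G) ?b' ?n"
  have v: "unitary_pair (carrier G) (group_vN G) ?v (op_mult (carrier G) ?n' ?b)"
    by (rule vN_unitary_pair_normal[OF B N normal bn bn'])
  have vd: "?v (delta \<one>) x = ?n (delta \<one>) x - of_real r * ?n (delta \<one>) (a \<otimes> x)"
    if "x \<in> carrier G" for x
    using that a neumann_ell2(1)[OF r a d] by (simp add: op_mult_apply d one_minus_apply left_reg_apply)
  have pow: "a [^] k \<noteq> \<one>" if "0 < k" for k :: nat
    using that a ord by (simp add: pow_eq_id)
  have nonpow: "inv a \<noteq> a [^] k" "inv a \<otimes> inv a \<noteq> a [^] k" for k :: nat
  proof -
    show "inv a \<noteq> a [^] k"
      using pow[of "Suc k"] a by (metis nat_pow_Suc l_inv zero_less_Suc)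
    show "inv a \<otimes> inv a \<noteq> a [^] k"
    proof
      assume "inv a \<otimes> inv a = a [^] k"
      then have "a [^] Suc (Suc k) = inv a \<otimes> inv a \<otimes> a \<otimes> a" by simp
      then show False using pow[of "Suc (Suc k)"] a by (simp add: m_assoc)
    qed
  qed
  have "?n (delta \<one>) (inv a) = 0" "?n (delta \<one>) (inv a \<otimes> inv a) = 0"
    using nonpow by (simp_all add: neumann_delta[OF r a])
  moreover have "?n (delta \<one>) \<one> = 1"
  proof -
    have "(\<lambda>k. if \<one> = a [^] k then complex_of_real (r ^ k) else 0) = (\<lambda>k. if k = 0 then 1 else 0)"
      using pow by (auto simp: fun_eq_iff) (metis gr0I)+
    then show ?thesis by (simp add: neumann_delta[OF r a] sums_unique[OF sums_single[of 0 "\<lambda>_. 1"], symmetric])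
  qed
  moreover have "?n (delta \<one>) a = of_real r"
  proof -
    have "a \<noteq> a [^] k" if "k \<noteq> 1" for k :: nat
    proof
      assume *: "a = a [^] k"
      show False
      proof (cases k)
        case 0
        then show False using * pow[of 1] a by simp
      next
        case (Suc j)
        then have "a [^] j = \<one>" using * a by (metis nat_pow_Suc l_cancel_one' nat_pow_closed r_cancel_one')
        then show False using pow[of j] Suc that by auto
      qed
    qed
    then have "(\<lambda>k. if a = a [^] k then complex_of_real (r ^ k) else 0)
        = (\<lambda>k. if k = 1 then of_real r else 0)"
      using a by (auto simp: fun_eq_iff)
    then show ?thesis by (simp add: neumann_delta[OF r a] sums_unique[OF sums_single[of "Suc 0" "\<lambda>_. of_real r"], symmetric])
  qed
  ultimately have "?v (delta \<one>) (inv a \<otimes> inv a) = 0" "?v (delta \<one>) (inv a) = - of_real r"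
    "?v (delta \<one>) \<one> = 1 - of_real r * of_real r"
    using a by (simp_all add: vd m_assoc[symmetric])
  moreover have "inv a \<noteq> \<one>" using pow[of 1] a by (simp add: inv_eq_1_iff)
  ultimately show thesis by (intro that[OF v]) (auto simp: r_def complex_eq_iff)
qed

end


section \<open>Trace-zero unitaries with two Fourier coefficients\<close>

theorem proposition5p8:
  fixes G :: "('a, 'b) monoid_scheme"
  assumes "group G"
    and "countable (carrier G)"
    and "infinite (carrier G) \<or> card (carrier G) \<ge> 4"
  shows "\<exists>u \<in> group_vN G. unitary_op (carrier G) u \<and> vN_trace G u = 0 \<and>
    (\<exists>g \<in> carrier G. \<exists>h \<in> carrier G. g \<noteq> h \<and>
      fourier_coeff G u g \<noteq> 0 \<and> fourier_coeff G u h \<noteq> 0)"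
proof -
  interpret group G by fact
  have large: "\<not> carrier G \<subseteq> F" if "finite F" "card F < 4" for F
    using assms(3) that card_mono[of F "carrier G"] finite_subset[of "carrier G" F] by auto
  obtain a where a: "a \<in> carrier G" "a \<noteq> \<one>\<^bsub>G\<^esub>" using large[of "{\<one>\<^bsub>G\<^esub>}"] by auto
  consider "ord a = 0" | "4 \<le> ord a" | "2 \<le> ord a" "ord a < 4"
    using ord_eq_1[OF a(1)] a(2) by linarith
  then show ?thesis
  proof cases
    case 1
    obtain v w where "unitary_pair (carrier G) (group_vN G) v w"
      "v (delta \<one>\<^bsub>G\<^esub>) (inv\<^bsub>G\<^esub> a \<otimes>\<^bsub>G\<^esub> inv\<^bsub>G\<^esub> a) = 0"
      "v (delta \<one>\<^bsub>G\<^esub>) (inv\<^bsub>G\<^esub> a) \<noteq> 0" "v (delta \<one>\<^bsub>G\<^esub>) \<one>\<^bsub>G\<^esub> \<noteq> 0" "inv\<^bsub>G\<^esub> a \<noteq> \<one>\<^bsub>G\<^esub>"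
      by (rule vanishing_coefficient_infinite_order[OF a(1) 1])
    with a(1) show ?thesis
      by (intro unitary_of_vanishing_coefficient[of v w _ "inv\<^bsub>G\<^esub> a" "\<one>\<^bsub>G\<^esub>"]) auto
  next
    case 2
    obtain v w where "unitary_pair (carrier G) (group_vN G) v w" "v (delta \<one>\<^bsub>G\<^esub>) a = 0"
      "v (delta \<one>\<^bsub>G\<^esub>) (a [^]\<^bsub>G\<^esub> (2::nat)) \<noteq> 0" "v (delta \<one>\<^bsub>G\<^esub>) (a [^]\<^bsub>G\<^esub> (3::nat)) \<noteq> 0"
      "a [^]\<^bsub>G\<^esub> (2::nat) \<noteq> a [^]\<^bsub>G\<^esub> (3::nat)"
      by (rule vanishing_coefficient_order_ge_4[OF a(1) 2])
    with a(1) show ?thesis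
      by (intro unitary_of_vanishing_coefficient[of v w a "a [^]\<^bsub>G\<^esub> (2::nat)" "a [^]\<^bsub>G\<^esub> (3::nat)"]) auto
  next
    case 3
    have "card ((\<lambda>k. a [^]\<^bsub>G\<^esub> k) ` {..<ord a}) < 4"
      using card_image_le[of "{..<ord a}" "\<lambda>k. a [^]\<^bsub>G\<^esub> k"] 3 by simp
    then obtain c where c: "c \<in> carrier G" "\<And>k. k < ord a \<Longrightarrow> c \<noteq> a [^]\<^bsub>G\<^esub> k"
      using large[of "(\<lambda>k. a [^]\<^bsub>G\<^esub> k) ` {..<ord a}"] by auto
    obtain v w where "unitary_pair (carrier G) (group_vN G) v w" "v (delta \<one>\<^bsub>G\<^esub>) c = 0"
      "v (delta \<one>\<^bsub>G\<^esub>) \<one>\<^bsub>G\<^esub> \<noteq> 0" "v (delta \<one>\<^bsub>G\<^esub>) a \<noteq> 0"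
      by (rule vanishing_coefficient_outside_cyclic[OF a(1) 3(1) c(2)])
    with a c(1) show ?thesis
      by (intro unitary_of_vanishing_coefficient[of v w c "\<one>\<^bsub>G\<^esub>" a]) auto
  qed
qed

end
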